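(* Let $n\geq 3$ be an odd integer and $k\geq 3$ an integer. Then the minimum size of a doubly resolving set of vertices of the Cartesian product $C_n\Box P_k$ is $3$, i.e. $\psi(C_n\Box P_k)=3$.
   Context: $C_n$ denotes the cycle on $n$ vertices and $P_k$ the path on $k$ vertices. For graphs $G,H$, the Cartesian product $G\Box H$ has vertex set $V(G)\times V(H)$, with $(g_1,h_1)$ adjacent to $(g_2,h_2)$ iff either $h_1=h_2$ and $g_1g_2\in E(G)$, or $g_1=g_2$ and $h_1h_2\in E(H)$. For a connected graph $G$ and an ordered set $Q=\{q_1,\dots,q_l\}\subseteq V(G)$, $r(x|Q)=(d(x,q_1),\dots,d(x,q_l))$, where $d$ is the shortest-path distance. $Q$ is a doubly resolving set if for any two distinct vertices $x,y$, $r(x|Q)-r(y|Q)\neq\lambda(1,\dots,1)$ for every integer $\lambda$. $\psi(G)$ is the minimum size of a doubly resolving set of $G$. *)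

theory Defs
  imports "Graph_Theory.Graph_Theory"
begin

text \<open>
  A finite simple graph is a \<^locale>\<open>pair_graph\<close>: an undirected edge uv is
  the pair of opposite arcs (u, v) and (v, u).
\<close>

definition cycle_graph :: "nat \<Rightarrow> nat pair_pre_digraph" where
  "cycle_graph n = \<lparr> pverts = {0..<n},
     parcs = {(i, j). i < n \<and> j < n \<and> (j = (i + 1) mod n \<or> i = (j + 1) mod n)} \<rparr>"

definition path_graph :: "nat \<Rightarrow> nat pair_pre_digraph" where
  "path_graph k = \<lparr> pverts = {0..<k},
     parcs = {(i, j). i < k \<and> j < k \<and> (j = i + 1 \<or> i = j + 1)} \<rparr>"

definition cartesian_product ::
    "'a pair_pre_digraph \<Rightarrow> 'b pair_pre_digraph \<Rightarrow> ('a \<times> 'b) pair_pre_digraph"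
    (infixr "\<box>" 80) where
  "G \<box> H = \<lparr> pverts = pverts G \<times> pverts H,
     parcs = {((g1, h1), (g2, h2)).
       g1 \<in> pverts G \<and> h1 \<in> pverts H \<and> g2 \<in> pverts G \<and> h2 \<in> pverts H \<and>
       (h1 = h2 \<and> (g1, g2) \<in> parcs G \<or> g1 = g2 \<and> (h1, h2) \<in> parcs H)} \<rparr>"

text \<open>The value of the distance is unspecified if there is no walk from u to v.\<close>

definition graph_dist :: "'a pair_pre_digraph \<Rightarrow> 'a \<Rightarrow> 'a \<Rightarrow> nat" where
  "graph_dist G u v = (LEAST l. \<exists>p. pre_digraph.awalk (with_proj G) u p v \<and> length p = l)"

text \<open>An ordered set of vertices is a list without repetitions.\<close>

definition metric_rep :: "'a pair_pre_digraph \<Rightarrow> 'a \<Rightarrow> 'a list \<Rightarrow> int list" where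
  "metric_rep G x Q = map (\<lambda>q. int (graph_dist G x q)) Q"

definition doubly_resolving :: "'a pair_pre_digraph \<Rightarrow> 'a list \<Rightarrow> bool" where
  "doubly_resolving G Q \<longleftrightarrow> distinct Q \<and> set Q \<subseteq> pverts G \<and>
     (\<forall>x \<in> pverts G. \<forall>y \<in> pverts G. x \<noteq> y \<longrightarrow>
       (\<forall>c::int. map2 (-) (metric_rep G x Q) (metric_rep G y Q) \<noteq> replicate (length Q) c))"

definition psi :: "'a pair_pre_digraph \<Rightarrow> nat" where
  "psi G = (LEAST l. \<exists>Q. doubly_resolving G Q \<and> length Q = l)"

lemma pair_graph_cycle_graph:
  assumes "n \<ge> 3"
  shows "pair_graph (cycle_graph n)"
proof
  fix e assume "e \<in> parcs (cycle_graph n)"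
  then show "fst e \<noteq> snd e"
    using assms by (auto simp: cycle_graph_def mod_Suc split: if_splits)
next
  show "finite (parcs (cycle_graph n))"
    by (rule finite_subset[of _ "{0..<n} \<times> {0..<n}"]) (auto simp: cycle_graph_def)
qed (auto simp: cycle_graph_def arcs_ends_conv symmetric_def sym_def)

lemma pair_graph_path_graph: "pair_graph (path_graph k)"
proof
  show "finite (parcs (path_graph k))"
    by (rule finite_subset[of _ "{0..<k} \<times> {0..<k}"]) (auto simp: path_graph_def)
qed (auto simp: path_graph_def arcs_ends_conv symmetric_def sym_def)

lemma pair_graph_cartesian_product:
  assumes "pair_graph G" and "pair_graph H"
  shows "pair_graph (G \<box> H)"
proof -
  interpret G: pair_graph G by fact
  interpret H: pair_graph H by fact
  show ?thesis
  proof
    show "finite (parcs (G \<box> H))"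
      by (rule finite_subset[of _ "(pverts G \<times> pverts H) \<times> (pverts G \<times> pverts H)"])
        (auto simp: cartesian_product_def)
    show "symmetric (with_proj (G \<box> H))"
      using G.pair_sym_arcs H.pair_sym_arcs
      by (auto simp: cartesian_product_def symmetric_def sym_def)
  qed (auto simp: cartesian_product_def dest: G.pair_no_loops H.pair_no_loops)
qed

text \<open>
  Between vertices joined by a walk, the distance is the library's
  shortest-path distance with unit weights.
\<close>

lemma (in pair_wf_digraph) graph_dist_eq_mu:
  assumes "u \<rightarrow>\<^sup>*\<^bsub>with_proj G\<^esub> v"
  shows "\<mu> (\<lambda>_. 1) u v = ereal (real (graph_dist G u v))"
proof -
  have cost: "awalk_cost (\<lambda>_. 1) p = real (length p)" for p :: "('a \<times> 'a) list"
    by (induct p) auto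
  have ex: "\<exists>l p. awalk u p v \<and> length p = l"
    using assms by (auto simp: reachable_awalk)
  obtain p where "awalk u p v" "length p = graph_dist G u v"
    using LeastI_ex[OF ex] unfolding graph_dist_def by blast
  moreover have "graph_dist G u v \<le> length q" if "awalk u q v" for q
    unfolding graph_dist_def using that by (blast intro: Least_le)
  ultimately show ?thesis
    unfolding \<mu>_def cost by (intro INF_eqI) (auto, metis ereal_less_eq(3))
qed

end

theory Submission
  imports Defs
begin

text \<open>
  Distances in \<open>C\<^sub>n \<box> P\<^sub>k\<close> add up coordinatewise. Write \<open>n = 2m + 1\<close>.
  Lower bound: for two vertices q and r the difference \<open>d(x,q) - d(x,r)\<close> has absolute value at
  most \<open>m + (k - 1)\<close>, so it takes at most \<open>n + 2k - 2\<close> values; this is less than \<open>nk\<close>, so two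
  vertices x share the same difference. Upper bound: \<open>{(0,0), (m,0), (0,k-1)}\<close> is doubly
  resolving, because the first two vertices determine the cycle coordinate (this uses that n is
  odd) and then the first and the third determine the path coordinate.
\<close>

section \<open>Certificates for shortest-path distances\<close>

definition is_dist_to :: "'a pair_pre_digraph \<Rightarrow> 'a \<Rightarrow> ('a \<Rightarrow> nat) \<Rightarrow> bool" where
  "is_dist_to G v f \<longleftrightarrow> v \<in> pverts G \<and> f v = 0 \<and>
     (\<forall>u w. (u, w) \<in> parcs G \<longrightarrow> f u \<le> f w + 1) \<and>
     (\<forall>u \<in> pverts G. u \<noteq> v \<longrightarrow> (\<exists>w \<in> pverts G. (u, w) \<in> parcs G \<and> f u = f w + 1))"

text \<open>Each arc of the walk lowers \<open>f\<close> by at most 1, and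
  \<open>f v = 0\<close>.\<close>

lemma is_dist_to_le_length:
  assumes "is_dist_to G v f" and "set p \<subseteq> parcs G" and "pcas u p v"
  shows "f u \<le> length p"
  using assms(2,3)
proof (induct p arbitrary: u)
  case Nil
  then show ?case
    using assms(1) by (simp add: is_dist_to_def)
next
  case (Cons e p)
  have "f (fst e) \<le> f (snd e) + 1"
    using assms(1) Cons.prems(1) by (cases e) (auto simp: is_dist_to_def)
  moreover have "f (snd e) \<le> length p"
    using Cons by simp
  ultimately show ?case
    using Cons.prems(2) by simp
qed

text \<open>Moving repeatedly to a neighbour where \<open>f\<close> is smaller by 1 can stop only at
  \<open>v\<close>.\<close>

lemma is_dist_to_walk:
  assumes "is_dist_to G v f" and "u \<in> pverts G"
  shows "\<exists>p. set p \<subseteq> parcs G \<and> pcas u p v \<and> length p = f u"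
  using assms(2)
proof (induct "f u" arbitrary: u rule: less_induct)
  case less
  show ?case
  proof (cases "u = v")
    case True
    then show ?thesis
      using assms(1) by (intro exI[of _ "[]"]) (simp add: is_dist_to_def)
  next
    case False
    then obtain w where w: "w \<in> pverts G" "(u, w) \<in> parcs G" "f u = f w + 1"
      using assms(1) less.prems unfolding is_dist_to_def by blast
    then obtain p where "set p \<subseteq> parcs G" "pcas w p v" "length p = f w"
      using less.hyps[of w] by auto
    then show ?thesis
      using w by (intro exI[of _ "(u, w) # p"]) simp
  qed
qed

text \<open>Reduces a distance formula to a check on single arcs, with no reasoning about shortest
  walks.\<close>

lemma graph_dist_eq:
  assumes "is_dist_to G v f" and "u \<in> pverts G"
  shows "graph_dist G u v = f u"
  unfolding graph_dist_def pre_digraph.awalk_def cas_with_proj_eq with_proj_simps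
  using is_dist_to_walk[OF assms] is_dist_to_le_length[OF assms(1)] assms(2)
  by (intro Least_equality) auto

text \<open>An arc changes only one coordinate, so the sum also changes by at most 1. To descend,
  move the first coordinate until it equals \<open>a\<close>, then the second.\<close>

lemma is_dist_to_cartesian_product:
  assumes f: "is_dist_to G a f" and h: "is_dist_to H b h"
  shows "is_dist_to (G \<box> H) (a, b) (\<lambda>(x, y). f x + h y)"
proof -
  have "\<exists>w \<in> pverts (G \<box> H). ((x, y), w) \<in> parcs (G \<box> H) \<and>
          f x + h y = (case w of (x', y') \<Rightarrow> f x' + h y') + 1"
    if xy: "x \<in> pverts G" "y \<in> pverts H" "(x, y) \<noteq> (a, b)" for x y
  proof (cases "x = a")
    case False
    then obtain w where "w \<in> pverts G" "(x, w) \<in> parcs G" "f x = f w + 1"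
      using f xy unfolding is_dist_to_def by blast
    then show ?thesis
      using xy by (intro bexI[of _ "(w, y)"]) (auto simp: cartesian_product_def)
  next
    case True
    then obtain w where "w \<in> pverts H" "(y, w) \<in> parcs H" "h y = h w + 1"
      using h xy unfolding is_dist_to_def by blast
    then show ?thesis
      using xy by (intro bexI[of _ "(x, w)"]) (auto simp: cartesian_product_def)
  qed
  then show ?thesis
    using f h unfolding is_dist_to_def by (auto simp: cartesian_product_def)
qed

section \<open>Distances in cycles, paths and their products\<close>

definition cycle_dist :: "nat \<Rightarrow> nat \<Rightarrow> nat \<Rightarrow> nat" where
  "cycle_dist n a i = (let d = (if i \<le> a then a - i else i - a) in min d (n - d))"

definition path_dist :: "nat \<Rightarrow> nat \<Rightarrow> nat" where
  "path_dist b j = (if j \<le> b then b - j else j - b)"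

lemma is_dist_to_cycle:
  assumes "a < n"
  shows "is_dist_to (cycle_graph n) a (cycle_dist n a)"
proof -
  let ?f = "cycle_dist n a"
  \<comment> \<open>\<open>s\<close> and \<open>p\<close> are successor and predecessor modulo
    \<open>n\<close>, written without \<open>mod\<close> so that linear arithmetic applies.\<close>
  define s :: "nat \<Rightarrow> nat" where "s u = (if u + 1 = n then 0 else u + 1)" for u
  define p :: "nat \<Rightarrow> nat" where "p u = (if u = 0 then n - 1 else u - 1)" for u
  have s: "(u + 1) mod n = s u" if "u < n" for u
    using that by (auto simp: s_def)
  have p: "p u < n" "s (p u) = u" if "u < n" for u
    using that by (auto simp: s_def p_def)
  have lipschitz: "?f u \<le> ?f (s u) + 1 \<and> ?f (s u) \<le> ?f u + 1" if u: "u < n" for u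
  proof -
    consider "u + 1 = n" | "u + 1 < n" "u < a" | "u + 1 < n" "a \<le> u"
      using u by linarith
    then show ?thesis
      using assms unfolding cycle_dist_def s_def Let_def
      by cases (auto simp: min_def)
  qed
  have descent: "?f u = ?f (s u) + 1 \<or> ?f u = ?f (p u) + 1" if u: "u < n" "u \<noteq> a" for u
  proof -
    \<comment> \<open>The cases record on which side of \<open>a\<close> the vertex lies and whether
      the direct way or the way around through 0 is shorter; each one steps along the shorter
      way.\<close>
    consider "u < a" "2 * (a - u) \<le> n" | "u < a" "n < 2 * (a - u)"
      | "a < u" "2 * (u - a) \<le> n" | "a < u" "n < 2 * (u - a)"
      using u by (metis linorder_neqE_nat not_le)
    then show ?thesis
    proof cases
      case 1
      then have "?f u = ?f (s u) + 1"
        using u assms by (auto simp: cycle_dist_def Let_def min_def s_def)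
      then show ?thesis ..
    next
      case 2
      then have "?f u = ?f (p u) + 1"
        using u assms by (auto simp: cycle_dist_def Let_def min_def p_def)
      then show ?thesis ..
    next
      case 3
      then have "?f u = ?f (p u) + 1"
        using u assms by (auto simp: cycle_dist_def Let_def min_def p_def)
      then show ?thesis ..
    next
      case 4
      then have "?f u = ?f (s u) + 1"
        using u assms by (auto simp: cycle_dist_def Let_def min_def s_def)
      then show ?thesis ..
    qed
  qed
  have parcs: "(u, w) \<in> parcs (cycle_graph n) \<longleftrightarrow> u < n \<and> w < n \<and> (w = s u \<or> u = s w)" for u w
    using s by (auto simp: cycle_graph_def)
  have "s u < n" if "u < n" for u
    using that by (simp add: s_def)
  then have "\<exists>w \<in> {0..<n}. (u, w) \<in> parcs (cycle_graph n) \<and> ?f u = ?f w + 1"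
    if "u < n" "u \<noteq> a" for u
    unfolding parcs using descent[OF that] p[of u] that by (metis atLeastLessThan_iff zero_le)
  moreover have "?f u \<le> ?f w + 1" if "(u, w) \<in> parcs (cycle_graph n)" for u w
    using that lipschitz unfolding parcs by blast
  moreover have "?f a = 0"
    by (simp add: cycle_dist_def)
  ultimately show ?thesis
    using assms unfolding is_dist_to_def by (simp add: cycle_graph_def)
qed

lemma is_dist_to_path:
  assumes "b < k"
  shows "is_dist_to (path_graph k) b (path_dist b)"
proof -
  have "\<exists>w < k. (w = u + 1 \<or> u = w + 1) \<and> path_dist b u = path_dist b w + 1"
    if "u < k" "u \<noteq> b" for u
    using that assms
    by (intro exI[of _ "if u < b then u + 1 else u - 1"]) (auto simp: path_dist_def)
  then show ?thesis
    using assms unfolding is_dist_to_def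
    by (auto simp: path_graph_def Bex_def) (auto simp: path_dist_def)
qed

lemma graph_dist_cycle_path:
  assumes "i < n" "j < k" "a < n" "b < k"
  shows "graph_dist (cycle_graph n \<box> path_graph k) (i, j) (a, b) = cycle_dist n a i + path_dist b j"
  using graph_dist_eq[OF is_dist_to_cartesian_product[OF is_dist_to_cycle is_dist_to_path],
      of a n b k "(i, j)"] assms
  by (simp add: cartesian_product_def cycle_graph_def path_graph_def)

lemma pverts_cycle_path: "pverts (cycle_graph n \<box> path_graph k) = {0..<n} \<times> {0..<k}"
  by (simp add: cartesian_product_def cycle_graph_def path_graph_def)

section \<open>Lower bound: two vertices are not enough\<close>

lemma inj_on_if_doubly_resolving_pair:
  assumes "doubly_resolving G [q, r]"
  shows "inj_on (\<lambda>x. int (graph_dist G x q) - int (graph_dist G x r)) (pverts G)"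
proof (rule inj_onI, rule ccontr)
  fix x y
  assume "x \<in> pverts G" "y \<in> pverts G" "x \<noteq> y"
    "int (graph_dist G x q) - int (graph_dist G x r) =
     int (graph_dist G y q) - int (graph_dist G y r)"
  \<comment> \<open>The assumed equation rearranges to say that the two entries of the difference
    vector agree, so that vector is constant.\<close>
  then show False
    using assms unfolding doubly_resolving_def metric_rep_def by force
qed

lemma not_doubly_resolving_pair:
  assumes "n \<ge> 3" and "odd n" and "k \<ge> 3"
  shows "\<not> doubly_resolving (cycle_graph n \<box> path_graph k) [q, r]"
proof
  let ?G = "cycle_graph n \<box> path_graph k"
  let ?F = "\<lambda>x. int (graph_dist ?G x q) - int (graph_dist ?G x r)"
  assume dr: "doubly_resolving ?G [q, r]"
  obtain m where m: "n = 2 * m + 1"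
    using \<open>odd n\<close> by (auto elim: oddE)
  obtain a b where q: "q = (a, b)" "a < n" "b < k"
    using dr by (cases q) (auto simp: doubly_resolving_def pverts_cycle_path)
  obtain c d where r: "r = (c, d)" "c < n" "d < k"
    using dr by (cases r) (auto simp: doubly_resolving_def pverts_cycle_path)
  define D where "D = int (m + k - 1)"
  have "?F (i, j) \<in> {-D..D}" if "i < n" "j < k" for i j
  proof -
    \<comment> \<open>As \<open>n = 2 * m + 1\<close>, \<open>d\<close> and \<open>n - d\<close>
      cannot both exceed \<open>m\<close>.\<close>
    have "cycle_dist n e i \<le> m" for e
      unfolding cycle_dist_def Let_def m by linarith
    from this[of a] this[of c] have
      "\<bar>int (cycle_dist n a i) - int (cycle_dist n c i)\<bar> \<le> int m" by linarith
    moreover have "\<bar>int (path_dist b j) - int (path_dist d j)\<bar> \<le> int (k - 1)"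
      using that q r by (auto simp: path_dist_def)
    moreover have "D = int m + int (k - 1)"
      using \<open>k \<ge> 3\<close> by (simp add: D_def)
    ultimately show ?thesis
      using that q r by (simp add: graph_dist_cycle_path) linarith
  qed
  then have "?F ` pverts ?G \<subseteq> {-D..D}"
    unfolding pverts_cycle_path by auto
  then have "card (pverts ?G) \<le> card {-D..D}"
    using inj_on_if_doubly_resolving_pair[OF dr] by (intro card_inj_on_le) auto
  \<comment> \<open>The interval has \<open>2 * D + 1\<close> elements, and
    \<open>2 * m + 1 = n\<close>.\<close>
  then have "n * k \<le> n + 2 * (k - 1)"
    using \<open>k \<ge> 3\<close> by (simp add: pverts_cycle_path D_def m)
  \<comment> \<open>Subtract \<open>n\<close> from both sides; cancelling \<open>k - 1 > 0\<close>
    then leaves \<open>n \<le> 2\<close>.\<close>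
  then have "n * (k - 1) \<le> 2 * (k - 1)"
    using \<open>k \<ge> 3\<close> by (cases k) auto
  then show False
    using assms by simp
qed

lemma length_doubly_resolving_ge:
  assumes "n \<ge> 3" and "odd n" and "k \<ge> 3"
    and dr: "doubly_resolving (cycle_graph n \<box> path_graph k) Q"
  shows "length Q \<ge> 3"
proof (rule ccontr)
  let ?G = "cycle_graph n \<box> path_graph k"
  \<comment> \<open>Any two distinct vertices exclude lists of length 0 and 1, since a difference
    vector with at most one entry is constant.\<close>
  have xy: "(0, 0) \<in> pverts ?G" "(0, 1) \<in> pverts ?G" "(0::nat, 0::nat) \<noteq> (0, 1)"
    using assms by (auto simp: pverts_cycle_path)
  have sep: "map2 (-) (metric_rep ?G (0, 0) Q) (metric_rep ?G (0, 1) Q) \<noteq> replicate (length Q) c" for c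
    using dr xy unfolding doubly_resolving_def by blast
  assume "\<not> length Q \<ge> 3"
  then consider "Q = []" | q where "Q = [q]" | q r where "Q = [q, r]"
    \<comment> \<open>\<open>remdups_adj.cases\<close> serves only to split off lists of length 0, 1
      and at least 2.\<close>
    by (cases Q rule: remdups_adj.cases) (auto simp: Suc_le_eq)
  then show False
  proof cases
    case 1
    then show ?thesis using sep by (simp add: metric_rep_def)
  next
    case 2
    then show ?thesis using sep by (simp add: metric_rep_def) blast
  next
    case 3
    then show ?thesis using not_doubly_resolving_pair[OF assms(1-3)] dr by blast
  qed
qed

section \<open>Upper bound: three vertices suffice\<close>

lemma doubly_resolving_triple:
  assumes "m \<ge> 1" and "k \<ge> 3"
  shows "doubly_resolving (cycle_graph (2 * m + 1) \<box> path_graph k) [(0, 0), (m, 0), (0, k - 1)]"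
proof -
  let ?n = "2 * m + 1"
  let ?G = "cycle_graph ?n \<box> path_graph k"
  have "(i, j) = (i', j')"
    if v: "i < ?n" "j < k" "i' < ?n" "j' < k"
      and eq: "map2 (-) (metric_rep ?G (i, j) [(0, 0), (m, 0), (0, k - 1)])
          (metric_rep ?G (i', j') [(0, 0), (m, 0), (0, k - 1)]) = replicate 3 c" for i j i' j' c
  proof -
    have c1: "int (cycle_dist ?n 0 i + path_dist 0 j) - int (cycle_dist ?n 0 i' + path_dist 0 j') = c"
      and c2: "int (cycle_dist ?n m i + path_dist 0 j) - int (cycle_dist ?n m i' + path_dist 0 j') = c"
      and c3: "int (cycle_dist ?n 0 i + path_dist (k - 1) j)
        - int (cycle_dist ?n 0 i' + path_dist (k - 1) j') = c"
      using eq v assms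
      by (simp_all add: metric_rep_def graph_dist_cycle_path numeral_3_eq_3 del: of_nat_add)
    have "int (cycle_dist ?n 0 x) - int (cycle_dist ?n m x) =
        (if x \<le> m then 2 * int x - int m else 3 * int m + 1 - 2 * int x)" if "x < ?n" for x
      using that by (auto simp: cycle_dist_def Let_def min_def)
    \<comment> \<open>Subtracting \<open>c2\<close> from \<open>c1\<close> cancels \<open>c\<close>
      and the path distances.\<close>
    from this[OF v(1)] this[OF v(3)] c1 c2
    have "(if i \<le> m then 2 * int i - int m else 3 * int m + 1 - 2 * int i) =
        (if i' \<le> m then 2 * int i' - int m else 3 * int m + 1 - 2 * int i')"
      by linarith
    \<comment> \<open>The value has the parity of \<open>m\<close> on the half
      \<open>i \<le> m\<close> and the opposite parity on the other half, so it reveals the half; on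
      each half it is injective.\<close>
    then have "i = i'"
      by presburger
    moreover have "j = j'"
      \<comment> \<open>Once the cycle terms cancel, \<open>c1\<close> reads
        \<open>j - j' = c\<close> and \<open>c3\<close> reads \<open>j' - j = c\<close>.\<close>
      using c1 c3 v \<open>i = i'\<close> by (auto simp: path_dist_def split: if_splits)
    ultimately show ?thesis by simp
  qed
  then show ?thesis
    using assms unfolding doubly_resolving_def
    by (auto simp: pverts_cycle_path numeral_3_eq_3)
qed

theorem theorem3p1:
  fixes n k :: nat
  assumes "n \<ge> 3" and "odd n" and "k \<ge> 3"
  shows "psi (cycle_graph n \<box> path_graph k) = 3"
proof -
  obtain m where m: "n = 2 * m + 1"
    using \<open>odd n\<close> by (auto elim: oddE)
  then have "doubly_resolving (cycle_graph n \<box> path_graph k) [(0, 0), (m, 0), (0, k - 1)]"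
    using doubly_resolving_triple[of m k] assms by simp
  then show ?thesis
    unfolding psi_def
    by (intro Least_equality)
      (use length_doubly_resolving_ge[OF assms] in \<open>force+\<close>)
qed

end
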